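(* Let $A$ be a Hermitian (complex) $n\times n$ matrix and let $\mathcal{S},\mathcal{T}\subseteq\{1,\ldots,n\}$ be such that $|\mathcal{S}\cap\mathcal{T}|=|\mathcal{S}|-1=|\mathcal{T}|-1$. Then $$\det(A[\mathcal{S}\cup\mathcal{T}])\det(A[\mathcal{S}\cap\mathcal{T}])\le\det(A[\mathcal{S}])\det(A[\mathcal{T}]).$$
   Context: $A[\mathcal{S}]$ denotes the principal submatrix of $A$ with rows and columns indexed by $\mathcal{S}$, and $\det(A[\emptyset])=1$. *)

theory Defs
  imports
    "Jordan_Normal_Form.Determinant"
    "Jordan_Normal_Form.DL_Submatrix"
    "Jordan_Normal_Form.Schur_Decomposition"
begin

definition hermitian_mat :: "complex mat \<Rightarrow> bool" where
  "hermitian_mat A \<longleftrightarrow> mat_adjoint A = A"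

lemma hermitian_mat_iff_index:
  assumes A: "A \<in> carrier_mat n n"
  shows "hermitian_mat A \<longleftrightarrow> (\<forall>i<n. \<forall>j<n. A $$ (i, j) = cnj (A $$ (j, i)))"
proof -
  have idx: "mat_adjoint A $$ (i, j) = cnj (A $$ (j, i))" if "i < n" "j < n" for i j
    using A that by (simp add: mat_adjoint_def mat_of_rows_index)
  have dim: "dim_row (mat_adjoint A) = n" "dim_col (mat_adjoint A) = n"
    using A by (simp_all add: mat_adjoint_def)
  have "mat_adjoint A = A \<longleftrightarrow> (\<forall>i<n. \<forall>j<n. mat_adjoint A $$ (i, j) = A $$ (i, j))"
    unfolding mat_eq_iff dim carrier_matD[OF A] by blast
  also have "\<dots> \<longleftrightarrow> (\<forall>i<n. \<forall>j<n. A $$ (i, j) = cnj (A $$ (j, i)))"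
    using idx by metis
  finally show ?thesis
    unfolding hermitian_mat_def .
qed

text \<open>Rows and columns are indexed from 0, so an index set of an \<open>n \<times> n\<close> matrix is a subset
  of \<open>{..<n}\<close>. For the empty set this is the \<open>0 \<times> 0\<close> matrix, whose determinant is 1.

  Determinants of Hermitian matrices are elements of type \<^typ>\<open>complex\<close> that happen to be real;
  they are compared with the order of \<^theory>\<open>HOL-Library.Complex_Order\<close>, where
  \<open>z \<le> w\<close> means \<open>Re z \<le> Re w\<close> and \<open>Im z = Im w\<close>.\<close>

abbreviation principal_submatrix :: "'a mat \<Rightarrow> nat set \<Rightarrow> 'a mat" where
  "principal_submatrix A S \<equiv> submatrix A S S"

lemma det_principal_submatrix_empty: "det (principal_submatrix A {}) = 1"
  by (simp add: submatrix_def)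

end

theory Submission
  imports Defs
begin

text \<open>With \<open>S \<union> T = (S \<inter> T) \<union> {i, j}\<close>, the Desnanot--Jacobi identity for \<open>M = A[S \<union> T]\<close>
  expresses \<open>det A[S] det A[T] - det A[S \<union> T] det A[S \<inter> T]\<close> as the product of the \<open>(i, j)\<close> and
  \<open>(j, i)\<close> cofactors of \<open>M\<close>. These are complex conjugates of each other because \<open>M\<close> is Hermitian,
  so the product is nonnegative. The identity follows by multiplying \<open>M\<close> with the identity matrix
  whose columns \<open>i\<close> and \<open>j\<close> are replaced by those of the adjugate, and cancelling \<open>det M\<close>;
  the cancellation is justified for singular \<open>M\<close> by passing to \<open>M + x I\<close> over the polynomial ring.\<close>

section \<open>Principal minors over the original index set\<close>

text \<open>The Leibniz sum runs over permutations of \<open>K\<close> itself, so rows and columns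
  keep their indices in \<open>A\<close> and need no renumbering by \<open>pick\<close>.\<close>

definition principal_minor :: "'a :: comm_ring_1 mat \<Rightarrow> nat set \<Rightarrow> 'a" where
  "principal_minor A K = (\<Sum>p | p permutes K. signof p * (\<Prod>r\<in>K. A $$ (r, p r)))"

lemma principal_minor_cong:
  assumes "\<And>r c. r \<in> K \<Longrightarrow> c \<in> K \<Longrightarrow> A $$ (r, c) = B $$ (r, c)"
  shows "principal_minor A K = principal_minor B K"
  unfolding principal_minor_def
  using assms by (auto intro!: sum.cong prod.cong arg_cong2[where f = "(*)"] simp: permutes_in_image)

lemma principal_minor_full:
  assumes "A \<in> carrier_mat n n"
  shows "principal_minor A {..<n} = det A"
  using det_def'[OF assms] by (simp add: principal_minor_def atLeast0LessThan)

lemma principal_minor_doubleton: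
  assumes "i \<noteq> j"
  shows "principal_minor A {i, j} = A $$ (i, i) * A $$ (j, j) - A $$ (i, j) * A $$ (j, i)"
proof -
  have perms: "{p. p permutes {i, j}} = {id, transpose i j}"
    by (auto simp: permutes_doubleton_iff)
  have "transpose i j \<noteq> id"
    using assms by (metis id_apply transpose_apply_first)
  then show ?thesis
    using assms by (simp add: principal_minor_def perms sign_swap_id)
qed

lemma (in comm_ring_hom) hom_principal_minor:
  assumes "A \<in> carrier_mat n n" "K \<subseteq> {..<n}"
  shows "principal_minor (map_mat hom A) K = hom (principal_minor A K)"
proof -
  have "(\<Prod>r\<in>K. map_mat hom A $$ (r, p r)) = (\<Prod>r\<in>K. hom (A $$ (r, p r)))" if "p permutes K" for p
    using assms that by (intro prod.cong refl index_map_mat) (auto simp: permutes_in_image subset_iff)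
  then show ?thesis
    unfolding principal_minor_def by (simp add: hom_distribs)
qed

lemma bij_betw_pick:
  assumes "finite K"
  shows "bij_betw (pick K) {0..<card K} K"
proof -
  have "inj_on (pick K) {0..<card K}"
    by (rule linorder_inj_onI) (metis atLeastLessThan_iff nat_neq_iff pick_mono_le, auto)
  moreover have "pick K ` {0..<card K} \<subseteq> K"
    by (auto intro: pick_in_set_le)
  ultimately show ?thesis
    using assms by (simp add: bij_betw_def card_image card_subset_eq)
qed

text \<open>Conjugation by the bijection \<open>pick K\<close> turns the permutations of
  \<open>{0..<card K}\<close> into those of \<open>K\<close>, preserving signs and products, so the
  two Leibniz sums agree.\<close>

lemma det_principal_submatrix:
  assumes A: "A \<in> carrier_mat n n" and K: "K \<subseteq> {..<n}"
  shows "det (principal_submatrix A K) = principal_minor A K"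
proof -
  let ?I = "{0..<card K}"
  let ?f = "pick K"
  let ?F = "\<lambda>p. map_permutation ?I ?f p"
  have finK: "finite K"
    using K finite_subset by blast
  have bij: "bij_betw ?f ?I K"
    by (rule bij_betw_pick[OF finK])
  then have inj: "inj_on ?f ?I" and img: "?f ` ?I = K"
    by (auto simp: bij_betw_def)
  have "{i. i < n \<and> i \<in> K} = K"
    using K by auto
  then have sub: "principal_submatrix A K = mat (card K) (card K) (\<lambda>(i, j). A $$ (?f i, ?f j))"
    using A by (simp add: submatrix_def)
  \<comment> \<open>This explicit form of the conjugated permutation is the one for which the
    library provides a bijection between the two sets of permutations.\<close>
  have F: "?F = (\<lambda>p x. if x \<in> K then ?f (p (inv_into ?I ?f x)) else x)"
    by (auto simp: fun_eq_iff map_permutation_def restrict_id_def img)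
  have bijF: "bij_betw ?F {p. p permutes ?I} {p. p permutes K}"
    unfolding F by (rule bij_betw_permutations[OF bij])
  have "det (principal_submatrix A K)
      = (\<Sum>p | p permutes ?I. signof p * (\<Prod>i\<in>?I. principal_submatrix A K $$ (i, p i)))"
    by (rule det_def') (simp add: sub)
  also have "\<dots> = (\<Sum>p | p permutes ?I. signof (?F p) * (\<Prod>r\<in>K. A $$ (r, ?F p r)))"
  proof (rule sum.cong[OF refl])
    fix p assume "p \<in> {p. p permutes ?I}"
    then have p: "p permutes ?I" by simp
    have "(\<Prod>r\<in>K. A $$ (r, ?F p r)) = (\<Prod>i\<in>?I. A $$ (?f i, ?F p (?f i)))"
      using prod.reindex_bij_betw[OF bij, of "\<lambda>r. A $$ (r, ?F p r)"] by simp
    also have "\<dots> = (\<Prod>i\<in>?I. principal_submatrix A K $$ (i, p i))"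
    proof (rule prod.cong[OF refl])
      fix i assume i: "i \<in> ?I"
      moreover have "p i \<in> ?I"
        using p i by (simp only: permutes_in_image)
      ultimately show "A $$ (?f i, ?F p (?f i)) = principal_submatrix A K $$ (i, p i)"
        using inj img by (auto simp: F sub inv_into_f_f)
    qed
    finally show "signof p * (\<Prod>i\<in>?I. principal_submatrix A K $$ (i, p i))
        = signof (?F p) * (\<Prod>r\<in>K. A $$ (r, ?F p r))"
      using sign_map_permutation[OF inj p] by simp
  qed
  also have "\<dots> = principal_minor A K"
    unfolding principal_minor_def by (rule sum.reindex_bij_betw[OF bijF])
  finally show ?thesis .
qed

section \<open>Determinants of matrices with diagonal or unit columns\<close>

text \<open>A permutation of \<open>{..<n}\<close> that does not permute \<open>K\<close> moves some
  \<open>c\<close> outside \<open>K\<close>. Its factor in column \<open>c\<close> is then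
  off-diagonal, hence 0, so only permutations of \<open>K\<close> contribute.\<close>

lemma det_diagonal_columns:
  assumes A: "A \<in> carrier_mat n n" and K: "K \<subseteq> {..<n}"
    and zero: "\<And>r c. r < n \<Longrightarrow> c < n \<Longrightarrow> c \<notin> K \<Longrightarrow> r \<noteq> c \<Longrightarrow> A $$ (r, c) = 0"
  shows "det A = (\<Prod>c\<in>{..<n} - K. A $$ (c, c)) * principal_minor A K"
proof -
  have "det A = (\<Sum>p | p permutes {..<n}. signof p * (\<Prod>r<n. A $$ (r, p r)))"
    using principal_minor_full[OF A] by (simp add: principal_minor_def)
  also have "\<dots> = (\<Sum>p | p permutes K. signof p * (\<Prod>r<n. A $$ (r, p r)))"
  proof (rule sum.mono_neutral_right)
    show "finite {p. p permutes {..<n}}"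
      by (simp add: finite_permutations)
    show "{p. p permutes K} \<subseteq> {p. p permutes {..<n}}"
      using K by (auto intro: permutes_subset)
    show "\<forall>p\<in>{p. p permutes {..<n}} - {p. p permutes K}. signof p * (\<Prod>r<n. A $$ (r, p r)) = 0"
    proof
      fix p assume "p \<in> {p. p permutes {..<n}} - {p. p permutes K}"
      then have p: "p permutes {..<n}" and "\<not> p permutes K" by auto
      then obtain c where c: "c \<in> {..<n} - K" "p c \<noteq> c"
        using permutes_superset by blast
      obtain r where pr: "p r = c"
        using permutes_surj[OF p] by (metis surjD)
      have "r \<in> {..<n}"
        using c pr permutes_in_image[OF p, of r] by auto
      moreover have "r \<noteq> c"
        using pr c(2) by metis
      ultimately have "A $$ (r, p r) = 0"
        using c pr zero[of r c] by simp
      then have "(\<Prod>r<n. A $$ (r, p r)) = 0"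
        using \<open>r \<in> {..<n}\<close> by (intro prod_zero) auto
      then show "signof p * (\<Prod>r<n. A $$ (r, p r)) = 0" by simp
    qed
  qed
  also have "\<dots> = (\<Sum>p | p permutes K. (\<Prod>c\<in>{..<n} - K. A $$ (c, c)) *
      (signof p * (\<Prod>r\<in>K. A $$ (r, p r))))"
  proof (rule sum.cong[OF refl])
    fix p assume "p \<in> {p. p permutes K}"
    then have p: "p permutes K" by simp
    have "(\<Prod>r<n. A $$ (r, p r)) = (\<Prod>r\<in>{..<n} - K. A $$ (r, p r)) * (\<Prod>r\<in>K. A $$ (r, p r))"
      using K by (intro prod.subset_diff) auto
    also have "(\<Prod>r\<in>{..<n} - K. A $$ (r, p r)) = (\<Prod>r\<in>{..<n} - K. A $$ (r, r))"
      using permutes_not_in[OF p] by (intro prod.cong) auto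
    finally show "signof p * (\<Prod>r<n. A $$ (r, p r))
        = (\<Prod>c\<in>{..<n} - K. A $$ (c, c)) * (signof p * (\<Prod>r\<in>K. A $$ (r, p r)))"
      by (simp add: mult_ac)
  qed
  also have "\<dots> = (\<Prod>c\<in>{..<n} - K. A $$ (c, c)) * principal_minor A K"
    by (simp add: principal_minor_def sum_distrib_left)
  finally show ?thesis .
qed

lemma det_unit_columns:
  assumes A: "A \<in> carrier_mat n n" and K: "K \<subseteq> {..<n}"
    and unit: "\<And>r c. r < n \<Longrightarrow> c < n \<Longrightarrow> c \<notin> K \<Longrightarrow> A $$ (r, c) = (if r = c then 1 else 0)"
  shows "det A = principal_minor A K"
proof -
  have "det A = (\<Prod>c\<in>{..<n} - K. A $$ (c, c)) * principal_minor A K"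
    using unit by (intro det_diagonal_columns[OF A K]) simp
  moreover have "(\<Prod>c\<in>{..<n} - K. A $$ (c, c)) = 1"
    using unit by (intro prod.neutral) simp
  ultimately show ?thesis by simp
qed

text \<open>Replacing column \<open>i\<close> by the unit vector leaves the cofactor at
  \<open>(i, i)\<close> unchanged, and Laplace expansion along that column makes it the whole
  determinant.\<close>

lemma cofactor_diagonal:
  assumes A: "A \<in> carrier_mat n n" and i: "i < n"
  shows "cofactor A i i = principal_minor A ({..<n} - {i})"
proof -
  define X where "X = mat n n (\<lambda>(r, c). if c = i then if r = i then 1 else 0 else A $$ (r, c))"
  have X: "X \<in> carrier_mat n n"
    by (simp add: X_def)
  have "mat_delete X i i = mat_delete A i i"
    using A i by (auto simp: mat_delete_def X_def)
  then have "cofactor A i i = cofactor X i i"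
    by (simp add: cofactor_def)
  also have "\<dots> = (\<Sum>r<n. if r = i then cofactor X r i else 0)"
    using i by simp
  also have "\<dots> = (\<Sum>r<n. X $$ (r, i) * cofactor X r i)"
    using i by (intro sum.cong) (auto simp: X_def)
  also have "\<dots> = det X"
    using laplace_expansion_column[OF X i] by simp
  also have "\<dots> = principal_minor X ({..<n} - {i})"
    by (rule det_unit_columns[OF X]) (auto simp: X_def)
  also have "\<dots> = principal_minor A ({..<n} - {i})"
    by (rule principal_minor_cong) (auto simp: X_def)
  finally show ?thesis .
qed

section \<open>The Desnanot-Jacobi identity\<close>

lemma desnanot_jacobi_nonsingular:
  fixes M :: "'a :: idom mat"
  assumes M: "M \<in> carrier_mat n n" and ij: "i < n" "j < n" "i \<noteq> j" and det: "det M \<noteq> 0"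
  shows "det M * principal_minor M ({..<n} - {i, j})
    = cofactor M i i * cofactor M j j - cofactor M i j * cofactor M j i"
proof -
  let ?d = "det M"
  define B where "B = mat n n (\<lambda>(r, c). if c = i \<or> c = j then adj_mat M $$ (r, c)
    else if r = c then 1 else 0)"
  \<comment> \<open>Columns \<open>i\<close> and \<open>j\<close> of \<open>M * adj_mat M\<close>
    are \<open>?d\<close> times unit vectors; the remaining columns of \<open>B\<close> reproduce
    those of \<open>M\<close>.\<close>
  define X where "X = mat n n (\<lambda>(r, c). if c = i \<or> c = j then if r = c then ?d else 0
    else M $$ (r, c))"
  have B: "B \<in> carrier_mat n n" and X: "X \<in> carrier_mat n n"
    by (simp_all add: B_def X_def)
  have adj: "adj_mat M \<in> carrier_mat n n" "M * adj_mat M = ?d \<cdot>\<^sub>m 1\<^sub>m n"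
    using adj_mat[OF M] by auto
  have "M * B = X"
  proof (rule eq_matI)
    fix r c assume "r < dim_row X" "c < dim_col X"
    then have rc: "r < n" "c < n" using X by auto
    show "(M * B) $$ (r, c) = X $$ (r, c)"
    proof (cases "c = i \<or> c = j")
      case True
      then have "col B c = col (adj_mat M) c"
        using rc adj(1) by (auto simp: B_def intro!: eq_vecI)
      then have "(M * B) $$ (r, c) = (M * adj_mat M) $$ (r, c)"
        using rc M B adj(1) by simp
      then show ?thesis
        using rc True by (simp add: adj(2) X_def)
    next
      case False
      then have "col B c = col (1\<^sub>m n) c"
        using rc by (auto simp: B_def intro!: eq_vecI)
      then have "(M * B) $$ (r, c) = (M * 1\<^sub>m n) $$ (r, c)"
        using rc M B by simp
      then show ?thesis
        using rc False M by (simp add: X_def)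
    qed
  qed (use M B X in auto)
  then have "?d * det B = det X"
    using det_mult[OF M B] by simp
  moreover have "det B = principal_minor B {i, j}"
    using ij by (intro det_unit_columns[OF B]) (auto simp: B_def)
  moreover have "det X = ?d * ?d * principal_minor M ({..<n} - {i, j})"
  proof -
    have "{..<n} - ({..<n} - {i, j}) = {i, j}"
      using ij by auto
    moreover have "principal_minor X ({..<n} - {i, j}) = principal_minor M ({..<n} - {i, j})"
      by (rule principal_minor_cong) (auto simp: X_def)
    ultimately show ?thesis
      using det_diagonal_columns[OF X, of "{..<n} - {i, j}"] ij by (auto simp: X_def)
  qed
  ultimately have "?d * (?d * principal_minor M ({..<n} - {i, j})) = ?d * principal_minor B {i, j}"
    by (metis mult.assoc)
  \<comment> \<open>Cancellation of one factor \<open>?d\<close> works in any integral domain, so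
    polynomial matrices are covered.\<close>
  then have "?d * principal_minor M ({..<n} - {i, j}) = principal_minor B {i, j}"
    using det mult_left_cancel by blast
  \<comment> \<open>The adjugate is the transposed cofactor matrix; the swap of
    \<open>(i, j)\<close> and \<open>(j, i)\<close> disappears in the product.\<close>
  also have "\<dots> = cofactor M i i * cofactor M j j - cofactor M i j * cofactor M j i"
    using ij M by (simp add: principal_minor_doubleton B_def adj_mat_def mult_ac)
  finally show ?thesis .
qed

lemma (in comm_ring_hom) hom_cofactor:
  assumes "A \<in> carrier_mat n n" "i < n" "j < n"
  shows "cofactor (map_mat hom A) i j = hom (cofactor A i j)"
proof -
  have "mat_delete (map_mat hom A) i j = map_mat hom (mat_delete A i j)"
    using assms by (auto simp: mat_delete_def)
  then show ?thesis
    by (simp add: cofactor_def hom_distribs)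
qed

lemma desnanot_jacobi:
  fixes M :: "'a :: field mat"
  assumes M: "M \<in> carrier_mat n n" and ij: "i < n" "j < n" "i \<noteq> j"
  shows "det M * principal_minor M ({..<n} - {i, j})
    = cofactor M i i * cofactor M j j - cofactor M i j * cofactor M j i"
proof -
  have ev: "comm_ring_hom (\<lambda>p :: 'a poly. poly p 0)"
    by unfold_locales auto
  \<comment> \<open>This is \<open>M + x I\<close>. Its determinant is the characteristic polynomial
    of \<open>- M\<close>, which is monic and hence nonzero; evaluation at 0 returns
    \<open>M\<close>.\<close>
  define N where "N = char_poly_matrix (- M)"
  have N: "N \<in> carrier_mat n n"
    using M by (simp add: N_def)
  have "det N \<noteq> 0"
    using degree_monic_char_poly[of "- M" n] M by (auto simp: N_def char_poly_def)
  note eq = desnanot_jacobi_nonsingular[OF N ij this]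
  have "map_mat (\<lambda>p. poly p 0) N = M"
    using M by (auto simp: N_def char_poly_matrix_def)
  then show ?thesis
    using arg_cong[OF eq, of "\<lambda>p. poly p 0"] ij
      comm_ring_hom.hom_det[OF ev, of N]
      comm_ring_hom.hom_principal_minor[OF ev N, of "{..<n} - {i, j}"]
      comm_ring_hom.hom_cofactor[OF ev N, of i i] comm_ring_hom.hom_cofactor[OF ev N, of j j]
      comm_ring_hom.hom_cofactor[OF ev N, of i j] comm_ring_hom.hom_cofactor[OF ev N, of j i]
    by auto
qed

section \<open>Hermitian matrices and the inequality\<close>

text \<open>The two deleted matrices are conjugate transposes of each other, and the sign of a
  cofactor is real and symmetric in \<open>i\<close> and \<open>j\<close>.\<close>

lemma cofactor_hermitian:
  assumes M: "M \<in> carrier_mat n n" and herm: "hermitian_mat M" and ij: "i < n" "j < n"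
  shows "cofactor M j i = cnj (cofactor M i j)"
proof -
  interpret cnj: comm_ring_hom cnj
    by unfold_locales auto
  have *: "M $$ (r, c) = cnj (M $$ (c, r))" if "r < n" "c < n" for r c
    using herm that unfolding hermitian_mat_iff_index[OF M] by blast
  have "mat_delete M j i = (map_mat cnj (mat_delete M i j))\<^sup>T"
    using M ij by (auto simp: mat_delete_def intro!: eq_matI *)
  then have "det (mat_delete M j i) = det (map_mat cnj (mat_delete M i j))"
    using det_transpose[of "map_mat cnj (mat_delete M i j)" "n - 1"] mat_delete_carrier[OF M] by simp
  then show ?thesis
    by (simp add: cofactor_def add.commute)
qed

theorem corollary4p2:
  fixes A :: "complex mat" and n :: nat and S T :: "nat set"
  assumes "A \<in> carrier_mat n n"
    and "hermitian_mat A"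
    and "S \<subseteq> {..<n}" and "T \<subseteq> {..<n}"
    and "int (card (S \<inter> T)) = int (card S) - 1"
    and "int (card S) - 1 = int (card T) - 1"
  shows "det (principal_submatrix A (S \<union> T)) * det (principal_submatrix A (S \<inter> T))
    \<le> det (principal_submatrix A S) * det (principal_submatrix A T)"
proof -
  note A = assms(1)
  have fin: "finite S" "finite T"
    using assms(3,4) finite_subset by blast+
  have "card (S - T) = 1" "card (T - S) = 1"
    using assms(5,6) fin card_Int_Diff[of S T] card_Int_Diff[of T S] by (auto simp: Int_commute)
  then obtain j i where j: "S - T = {j}" and i: "T - S = {i}"
    by (auto simp: card_1_singleton_iff)
  then have ij: "i < n" "j < n" "i \<noteq> j"
    using assms(3,4) by auto
  define U where "U = S \<union> T"
  have U: "U \<subseteq> {..<n}" "i \<in> U" "j \<in> U"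
    using assms(3,4) i j by (auto simp: U_def)
  \<comment> \<open>The index \<open>i\<close> lies in \<open>T\<close> only, so removing it from
    the union leaves \<open>S\<close>; removing \<open>j\<close> leaves \<open>T\<close>.\<close>
  have S: "S = U - {i}" and T: "T = U - {j}" and ST: "S \<inter> T = U - {i, j}"
    using i j by (auto simp: U_def)
  \<comment> \<open>\<open>A[U]\<close> extended by an identity block, so that the indices of \<open>A\<close> are kept\<close>
  define M where "M = mat n n (\<lambda>(r, c). if r \<in> U \<and> c \<in> U then A $$ (r, c)
    else if r = c then 1 else 0)"
  have M: "M \<in> carrier_mat n n"
    by (simp add: M_def)
  have hermA: "A $$ (r, c) = cnj (A $$ (c, r))" if "r < n" "c < n" for r c
    using assms(2) that unfolding hermitian_mat_iff_index[OF A] by blast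
  have "M $$ (r, c) = cnj (M $$ (c, r))" if "r < n" "c < n" for r c
    using that hermA[OF that] by (simp add: M_def)
  then have herm: "hermitian_mat M"
    unfolding hermitian_mat_iff_index[OF M] by blast
  have minor: "principal_minor M ({..<n} - D) = det (principal_submatrix A (U - D))"
    if "D \<subseteq> U" for D
  proof -
    \<comment> \<open>The rows and columns in \<open>D\<close> also become an identity block. Then
      \<open>det X\<close> reduces to the minor on \<open>{..<n} - D\<close> and equally to the one
      on \<open>U - D\<close>.\<close>
    define X where "X = mat n n (\<lambda>(r, c). if r \<in> D \<or> c \<in> D then if r = c then 1 else 0
      else M $$ (r, c))"
    have X: "X \<in> carrier_mat n n"
      by (simp add: X_def)
    have "principal_minor M ({..<n} - D) = principal_minor X ({..<n} - D)"
      by (rule principal_minor_cong) (auto simp: X_def)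
    also have "\<dots> = det X"
      by (rule det_unit_columns[OF X, symmetric]) (auto simp: X_def)
    also have "\<dots> = principal_minor X (U - D)"
      using U by (intro det_unit_columns[OF X]) (auto simp: X_def M_def)
    also have "\<dots> = principal_minor A (U - D)"
      using U by (intro principal_minor_cong) (auto simp: X_def M_def subset_iff)
    also have "\<dots> = det (principal_submatrix A (U - D))"
      using U by (intro det_principal_submatrix[OF A, symmetric]) auto
    finally show ?thesis .
  qed
  have "det M * det (principal_submatrix A (S \<inter> T))
      = det (principal_submatrix A S) * det (principal_submatrix A T) - cofactor M i j * cofactor M j i"
    using desnanot_jacobi[OF M ij] minor[of "{i, j}"] minor[of "{i}"] minor[of "{j}"] U ij
    by (simp add: cofactor_diagonal[OF M] flip: S T ST)
  moreover have "det M = det (principal_submatrix A (S \<union> T))"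
    using minor[of "{}"] by (simp add: principal_minor_full[OF M] U_def)
  \<comment> \<open>The product has the form \<open>z * cnj z\<close>: its imaginary part vanishes
    and its real part is a sum of squares.\<close>
  moreover have "0 \<le> cofactor M i j * cofactor M j i"
    unfolding cofactor_hermitian[OF M herm ij(1,2)] by (simp add: less_eq_complex_def)
  ultimately show ?thesis
    by simp
qed

end
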